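(* Let $m>p$, let $C\in\mathbb{R}^{p\times m}$ have full row rank $p$, and let $S_1\in\mathbb{R}^{m\times m}$ be nonsingular with $S_2=CS_1^{-1}C^T$ nonsingular. Suppose that $CS_1C^T$ is nonsingular, and define $\widehat{S}_2$ by $$\widehat{S}_2^{-1}=(CC^T)^{-1}\,C S_1 C^T\,(CC^T)^{-1}.$$ If $p>\frac{m}{2}$, then $1$ is an eigenvalue of $\widehat{S}_2^{-1}S_2$ of multiplicity at least $2p-m$.
   Context: This is the BFBt approximation $\widehat{S}_2$ of the nested Schur complement $S_2$ of a double saddle-point matrix $\begin{bmatrix} A & B^T & 0\\ B & -D & C^T\\ 0 & C & 0\end{bmatrix}$, where $S_1=D+BA^{-1}B^T$; the claim involves only $S_1$ and $C$. *)

theory Defs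
  imports
    "Jordan_Normal_Form.Gauss_Jordan_Elimination"
    "Jordan_Normal_Form.Char_Poly"
    "Jordan_Normal_Form.Matrix_Kernel"
    "Jordan_Normal_Form.DL_Rank"
begin

text \<open>
  The inverse of a nonsingular square matrix. The option-valued \<^const>\<open>mat_inverse\<close> returns
  \<^const>\<open>None\<close> for singular matrices, where \<open>mat_inv\<close> is therefore unspecified.
\<close>

definition mat_inv :: "'a :: field mat \<Rightarrow> 'a mat" where
  "mat_inv A = the (mat_inverse A)"

lemma mat_inv:
  fixes A :: "'a :: field mat"
  assumes A: "A \<in> carrier_mat n n" and inv: "invertible_mat A"
  shows "mat_inv A \<in> carrier_mat n n" "A * mat_inv A = 1\<^sub>m n" "mat_inv A * A = 1\<^sub>m n"
proof -
  from inv obtain B where AB: "A * B = 1\<^sub>m n" and BA: "B * A = 1\<^sub>m (dim_row B)"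
    using A unfolding invertible_mat_def inverts_mat_def by auto
  have "dim_col B = n" using arg_cong[OF AB, of dim_col] by simp
  moreover have "dim_row B = n" using arg_cong[OF BA, of dim_col] A by simp
  ultimately have "A \<in> Units (ring_mat TYPE('a) n ())"
    using A AB BA unfolding Units_def by (auto simp: ring_mat_simps intro!: bexI[of _ B])
  with mat_inverse(1)[OF A, of "()"] obtain B' where "mat_inverse A = Some B'"
    by (cases "mat_inverse A") auto
  with mat_inverse(2)[OF A this]
  show "mat_inv A \<in> carrier_mat n n" "A * mat_inv A = 1\<^sub>m n" "mat_inv A * A = 1\<^sub>m n"
    by (auto simp: mat_inv_def)
qed

definition geometric_multiplicity :: "'a :: field mat \<Rightarrow> 'a \<Rightarrow> nat" where
  "geometric_multiplicity A e = kernel_dim (char_matrix A e)"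

definition algebraic_multiplicity :: "'a :: field mat \<Rightarrow> 'a \<Rightarrow> nat" where
  "algebraic_multiplicity A e = Polynomial.order e (char_poly A)"

end

(* If C^T x = S1 C^T y, then C S1^{-1} C^T x = C C^T y, so applying Shat2^{-1} S2 to x gives
   (C C^T)^{-1} C S1 C^T y = (C C^T)^{-1} C C^T x = x. The pairs (x, y) with C^T x = S1 C^T y solve m
   equations in 2p unknowns, and y is determined by x because C^T is injective, so at least
   2p - m independent vectors x arise. Algebraic multiplicity dominates the geometric one. *)

theory Submission
  imports Defs
begin

section \<open>Kernels through Gaussian elimination\<close>

text \<open>Each row of the echelon form holds at most one pivot, so with fewer rows than columns
  some column has none. Such a free column yields a nonzero null vector, and row reduction does not
  change the kernel.\<close>

lemma ex_nonzero_kernel_vec: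
  fixes A :: "'a :: field mat"
  assumes A: "A \<in> carrier_mat nr nc" and wide: "nr < nc"
  obtains v where "v \<in> carrier_vec nc" "v \<noteq> 0\<^sub>v nc" "A *\<^sub>v v = 0\<^sub>v nr"
proof -
  define R where "R = gauss_jordan_single A"
  note gj = gauss_jordan_single[OF A R_def[symmetric]]
  have row: "row_echelon_form R" and R: "R \<in> carrier_mat nr nc" using gj by auto
  then obtain f where f: "pivot_fun R f nc" unfolding row_echelon_form_def by auto
  note pp = pivot_positions[OF R f]
  have "snd ` set (pivot_positions R) \<subseteq> f ` {0..<nr}" unfolding pp(1) by auto
  then have "card (snd ` set (pivot_positions R)) \<le> card {0..<nr}"
    by (meson card_image_le card_mono finite_atLeastLessThan finite_imageI order_trans)
  then have "snd ` set (pivot_positions R) \<noteq> {0..<nc}" using wide by auto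
  from find_base_vector[OF row R this] gj(1) that show thesis by blast
qed

text \<open>\<open>E\<close> reads off the free coordinates, those of the pivot-free columns, and
  there are \<open>kernel_dim A\<close> of them. A kernel vector is determined by these, since the
  echelon form expresses each pivot coordinate through them. This lets \<open>kernel_dim A\<close>
  extra linear equations cut the kernel down to zero.\<close>

lemma ex_kernel_coordinates:
  fixes A :: "'a :: field mat"
  assumes A: "A \<in> carrier_mat nr nc"
  obtains E where "E \<in> carrier_mat (kernel_dim A) nc"
    "\<And>v. v \<in> carrier_vec nc \<Longrightarrow> A *\<^sub>v v = 0\<^sub>v nr \<Longrightarrow> E *\<^sub>v v = 0\<^sub>v (kernel_dim A) \<Longrightarrow> v = 0\<^sub>v nc"
proof -
  define R where "R = gauss_jordan_single A"
  note gj = gauss_jordan_single[OF A R_def[symmetric]]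
  have row: "row_echelon_form R" and R: "R \<in> carrier_mat nr nc" using gj by auto
  then obtain f where f: "pivot_fun R f nc" unfolding row_echelon_form_def by auto
  note pp = pivot_positions[OF R f]
  note piv = pivot_funD[OF carrier_matD(1)[OF R] f]
  define P where "P = snd ` set (pivot_positions R)"
  \<comment> \<open>The pivot function signals a row without pivot by the out-of-range value
    \<open>nc\<close>.\<close>
  have P_eq: "P = {f i | i. i < nr \<and> f i < nc}"
    unfolding P_def pp(1) using piv(1) by (force simp: image_iff order_less_le)
  define js where "js = filter (\<lambda>j. j \<notin> P) [0..<nc]"
  \<comment> \<open>Pivots lie in distinct columns, so counting pivots and counting pivot columns
    agree; the remaining columns number \<open>kernel_dim A\<close>.\<close>
  have "card P = length (pivot_positions R)"
    using distinct_card[OF pp(3)] unfolding P_def by simp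
  moreover have "length js = card ({0..<nc} - P)"
    unfolding js_def by (subst distinct_card[symmetric]) (auto intro: arg_cong[of _ _ card])
  moreover have "card ({0..<nc} - P) = nc - card P"
    by (subst card_Diff_subset) (auto simp: P_eq intro: finite_subset[of _ "{0..<nc}"])
  ultimately have len: "length js = kernel_dim A"
    using A unfolding kernel_dim_code R_def by simp
  define E :: "'a mat" where "E = mat_of_rows nc (map (unit_vec nc) js)"
  show thesis
  proof
    show E: "E \<in> carrier_mat (kernel_dim A) nc" unfolding E_def using len by auto
    fix v :: "'a vec"
    assume v: "v \<in> carrier_vec nc" and Av: "A *\<^sub>v v = 0\<^sub>v nr"
      and Ev: "E *\<^sub>v v = 0\<^sub>v (kernel_dim A)"
    have Rv: "R *\<^sub>v v = 0\<^sub>v nr" using Av gj(1)[OF v] by simp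
    have free: "v $ j = 0" if j: "j < nc" "j \<notin> P" for j
    proof -
      have "j \<in> set js" using j by (simp add: js_def)
      then obtain i where i: "i < length js" "js ! i = j" by (auto simp: in_set_conv_nth)
      have "(E *\<^sub>v v) $ i = v $ j"
        using i j v by (simp add: E_def)
      then show ?thesis using Ev i len by simp
    qed
    show "v = 0\<^sub>v nc"
    proof (rule eq_vecI)
      fix j assume "j < dim_vec (0\<^sub>v nc :: 'a vec)"
      then have j: "j < nc" by simp
      show "v $ j = 0\<^sub>v nc $ j"
      proof (cases "j \<in> P")
        case True
        then obtain i where i: "i < nr" "j = f i" "f i < nc" unfolding P_eq by auto
        \<comment> \<open>Row \<open>i\<close> has entry 1 at its own pivot and 0 in all other pivot
          columns, while \<open>v\<close> vanishes at the free columns. Only \<open>v $ j\<close>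
          survives in the sum.\<close>
        have "0 = (R *\<^sub>v v) $ i" using Rv i by simp
        also have "\<dots> = (\<Sum>l\<in>{0..<nc}. R $$ (i, l) * v $ l)"
          using i R v by (auto simp: scalar_prod_def)
        also have "\<dots> = (\<Sum>l\<in>{0..<nc}. if l = j then v $ l else 0)"
        proof (rule sum.cong[OF refl])
          fix l assume "l \<in> {0..<nc}"
          then have l: "l < nc" by simp
          consider "l = j" | "l \<notin> P" | "l \<in> P" "l \<noteq> j" by blast
          then show "R $$ (i, l) * v $ l = (if l = j then v $ l else 0)"
          proof cases
            case 1
            then show ?thesis using piv(4)[OF i(1)] i by simp
          next
            case 2
            then show ?thesis using free[OF l] True by auto
          next
            case 3
            then obtain i' where "i' < nr" "l = f i'" "f i' < nc" unfolding P_eq by auto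
            then show ?thesis using piv(5)[of i' i] i 3 by auto
          qed
        qed
        also have "\<dots> = v $ j" using j by simp
        finally show ?thesis using j by simp
      next
        case False
        then show ?thesis using free j by simp
      qed
    qed (use v in simp)
  qed
qed

section \<open>Geometric versus algebraic multiplicity\<close>

text \<open>
  Gaussian elimination conjugates A - eI into a matrix with as many zero rows as its kernel has
  dimensions; each zero row pulls a factor X - e out of the characteristic determinant.
\<close>

lemma geometric_le_algebraic_multiplicity:
  fixes A :: "'a :: field mat"
  assumes A: "A \<in> carrier_mat n n"
  shows "geometric_multiplicity A e \<le> algebraic_multiplicity A e"
proof -
  define B where "B = char_matrix A e"
  have B: "B \<in> carrier_mat n n" unfolding B_def using A by simp
  have A_eq: "A = B + e \<cdot>\<^sub>m 1\<^sub>m n"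
    unfolding B_def char_matrix_def by (rule eq_matI) (use A in auto)
  define R where "R = gauss_jordan_single B"
  note gj = gauss_jordan_single[OF B R_def[symmetric]]
  have row: "row_echelon_form R" and R: "R \<in> carrier_mat n n" using gj by auto
  from gj(4) obtain P Q where PQ: "R = P * B" "P \<in> carrier_mat n n" "Q \<in> carrier_mat n n"
    "P * Q = 1\<^sub>m n" "Q * P = 1\<^sub>m n" by auto
  define Z where "Z = {i. i < n \<and> row R i = 0\<^sub>v n}"
  define N where "N = {i. i < n \<and> row R i \<noteq> 0\<^sub>v n}"
  have "kernel_dim B = n - card N"
    using find_base_vectors(5)[OF row R] B unfolding kernel_dim_code R_def N_def by simp
  moreover have "card Z + card N = n"
  proof -
    have "Z \<union> N = {0..<n}" "Z \<inter> N = {}" "finite Z" "finite N" unfolding Z_def N_def by auto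
    then show ?thesis by (metis card_Un_disjoint card_atLeastLessThan diff_zero)
  qed
  ultimately have geo: "geometric_multiplicity A e = card Z"
    unfolding geometric_multiplicity_def B_def by simp
  \<comment> \<open>As \<open>Q\<close> inverts \<open>P\<close>, this is the conjugate
    \<open>P * A * Q\<close>. Right multiplication by \<open>Q\<close> keeps the zero rows of
    \<open>R\<close>, so for \<open>i\<close> in \<open>Z\<close> row \<open>i\<close> of
    \<open>T\<close> is \<open>e\<close> times the unit row.\<close>
  define T where "T = R * Q + e \<cdot>\<^sub>m 1\<^sub>m n"
  have T: "T \<in> carrier_mat n n" unfolding T_def using PQ R by simp
  have "P * (e \<cdot>\<^sub>m 1\<^sub>m n) * Q = e \<cdot>\<^sub>m 1\<^sub>m n"
    using PQ mult_smult_distrib[of P n n "1\<^sub>m n" n e] mult_smult_assoc_mat[of P n n Q n e] by simp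
  then have "T = P * A * Q"
    unfolding T_def A_eq PQ(1) using PQ B
    by (simp add: mult_add_distrib_mat[of _ n n] add_mult_distrib_mat[of _ n n])
  then have "similar_mat T A"
    by (intro similar_matI[of _ _ P Q n]) (use A T PQ in auto)
  then have cp: "char_poly A = det (char_poly_matrix T)"
    using char_poly_similar unfolding char_poly_def by metis
  \<comment> \<open>\<open>D\<close> is diagonal and collects the factor X - e of each row in
    \<open>Z\<close>; \<open>Y\<close> is what is left, with unit rows there. Then det
    \<open>D\<close> divides the characteristic polynomial.\<close>
  define D where "D = mat n n (\<lambda>(i, j). if i \<noteq> j then 0 else if i \<in> Z then [:- e, 1:] else 1)"
  define Y where "Y = mat n n (\<lambda>(i, j). if i \<in> Z then if i = j then 1 else 0
    else char_poly_matrix T $$ (i, j))"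
  have D: "D \<in> carrier_mat n n" and Y: "Y \<in> carrier_mat n n" unfolding D_def Y_def by auto
  have "char_poly_matrix T = D * Y"
  proof (rule eq_matI)
    fix i j assume "i < dim_row (D * Y)" "j < dim_col (D * Y)"
    then have ij: "i < n" "j < n" using D Y by auto
    have "(D * Y) $$ (i, j) = (\<Sum>k\<in>{0..<n}. D $$ (i, k) * Y $$ (k, j))"
      using D Y ij by (simp add: scalar_prod_def)
    also have "\<dots> = (\<Sum>k\<in>{0..<n}. if k = i then D $$ (i, i) * Y $$ (i, j) else 0)"
      by (rule sum.cong) (use ij in \<open>auto simp: D_def\<close>)
    also have "\<dots> = D $$ (i, i) * Y $$ (i, j)" using ij by simp
    also have "\<dots> = char_poly_matrix T $$ (i, j)"
    proof (cases "i \<in> Z")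
      case True
      then have "row (R * Q) i $ j = 0"
        using ij PQ R by (auto simp: Z_def)
      then have "(R * Q) $$ (i, j) = 0" using ij R PQ by simp
      then have "T $$ (i, j) = (if i = j then e else 0)"
        using ij R PQ unfolding T_def by simp
      then show ?thesis using True ij T by (simp add: D_def Y_def char_poly_matrix_def)
    next
      case False
      then show ?thesis using ij by (simp add: D_def Y_def)
    qed
    finally show "char_poly_matrix T $$ (i, j) = (D * Y) $$ (i, j)" by simp
  qed (use D Y T in \<open>auto simp: char_poly_matrix_def\<close>)
  moreover have "det D = [:- e, 1:] ^ card Z"
  proof -
    have "det D = (\<Prod>i\<in>{0..<n}. if i \<in> Z then [:- e, 1:] else 1)"
      by (subst det_upper_triangular[OF _ D]) (auto simp: D_def prod_list_diag_prod)
    also have "\<dots> = (\<Prod>i\<in>Z. [:- e, 1:])"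
      by (rule prod.mono_neutral_cong_right) (auto simp: Z_def)
    finally show ?thesis by simp
  qed
  ultimately have "[:- e, 1:] ^ card Z dvd char_poly A"
    unfolding cp by (simp add: det_mult[OF D Y])
  \<comment> \<open>Divisibility bounds the root order only for a nonzero polynomial; this one is
    monic.\<close>
  moreover have "char_poly A \<noteq> 0"
    using degree_monic_char_poly[OF A] by (metis coeff_0 zero_neq_one)
  ultimately show ?thesis
    unfolding geo algebraic_multiplicity_def by (rule order_max)
qed

section \<open>Full row rank and the Gram matrix \<open>C * C\<^sup>T\<close>\<close>

text \<open>Rank \<open>n\<close> means that the columns of \<open>C\<close> span the whole space. A
  vector killed by the transpose has zero product with every column, hence with every unit vector,
  and those products are its coordinates.\<close>

lemma full_row_rank_transpose_inj:
  fixes C :: "'a :: field mat"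
  assumes C: "C \<in> carrier_mat n nc" and rk: "vec_space.rank n C = n"
    and x: "x \<in> carrier_vec n" and Cx: "C\<^sup>T *\<^sub>v x = 0\<^sub>v nc"
  shows "x = 0\<^sub>v n"
proof -
  interpret vec_space "TYPE('a)" n .
  have cols: "set (cols C) \<subseteq> carrier_vec n" using C cols_dim by blast
  \<comment> \<open>A maximal independent set of columns has as many elements as the rank, here
    \<open>n\<close>, and is therefore a basis.\<close>
  obtain S where S: "maximal S (\<lambda>T. T \<subseteq> set (cols C) \<and> lin_indpt T)"
    using maximal_exists_superset[of "set (cols C)" "\<lambda>T. T \<subseteq> set (cols C) \<and> lin_indpt T" "{}"]
    by (auto simp: lin_dep_def)
  have sub: "S \<subseteq> set (cols C)" and li: "lin_indpt S" using S by (auto simp: maximal_def)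
  have fin: "finite S" using sub by (rule finite_subset) simp
  have Sc: "S \<subseteq> carrier_vec n" using sub cols by blast
  have "card S = n" using rank_card_indpt[OF C S] rk by simp
  then have "basis S" using dim_li_is_basis fin Sc li dim_is_n by simp
  then have span: "span S = carrier_vec n" by (simp add: basis_def)
  have orth: "u \<bullet> x = 0" if "u \<in> S" for u
  proof -
    from that sub obtain j where j: "j < nc" "u = col C j"
      using C by (metis cols_length cols_nth in_set_conv_nth subsetD carrier_matD(2))
    have "(C\<^sup>T *\<^sub>v x) $ j = u \<bullet> x" using j C by simp
    then show ?thesis using Cx j by simp
  qed
  have "x $ i = 0" if i: "i < n" for i
  proof -
    have "unit_vec n i \<in> span S" using span by simp
    then obtain a T where T: "unit_vec n i = lincomb a T" "finite T" "T \<subseteq> S"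
      using in_spanE by blast
    have Tc: "T \<subseteq> carrier_vec n" using T Sc by blast
    have "x $ i = lincomb a T \<bullet> x" unfolding T(1)[symmetric] using x i by simp
    also have "\<dots> = (\<Sum>u\<in>T. (a u \<cdot>\<^sub>v u) \<bullet> x)"
      unfolding lincomb_def by (subst finsum_scalar_prod_sum) (use Tc x in auto)
    also have "\<dots> = 0"
      by (rule sum.neutral) (use T(3) Tc x orth in \<open>auto simp: smult_scalar_prod_distrib[of _ n] subset_iff\<close>)
    finally show ?thesis .
  qed
  then show ?thesis using x by (intro eq_vecI) auto
qed

text \<open>A null vector \<open>x\<close> of the Gram matrix makes the squared length of
  \<open>C\<^sup>T *\<^sub>v x\<close> zero. Over the reals that vector itself then vanishes, and
  injectivity gives \<open>x\<close> zero.\<close>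

lemma invertible_mat_mult_transpose:
  fixes C :: "real mat"
  assumes C: "C \<in> carrier_mat n nc"
    and inj: "\<And>x. x \<in> carrier_vec n \<Longrightarrow> C\<^sup>T *\<^sub>v x = 0\<^sub>v nc \<Longrightarrow> x = 0\<^sub>v n"
  shows "invertible_mat (C * C\<^sup>T)"
proof -
  have CC: "C * C\<^sup>T \<in> carrier_mat n n" using C by simp
  have "det (C * C\<^sup>T) \<noteq> 0"
  proof
    assume "det (C * C\<^sup>T) = 0"
    then obtain x where x: "x \<in> carrier_vec n" "x \<noteq> 0\<^sub>v n" "(C * C\<^sup>T) *\<^sub>v x = 0\<^sub>v n"
      unfolding det_0_iff_vec_prod_zero[OF CC] by auto
    define w where "w = C\<^sup>T *\<^sub>v x"
    have w: "w \<in> carrier_vec nc" unfolding w_def using C x by simp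
    have "C *\<^sub>v w = 0\<^sub>v n" unfolding w_def using x C by simp
    then have "w \<bullet> w = 0"
      using transpose_vec_mult_scalar[OF C w x(1)] x(1) by (simp add: w_def)
    moreover have "conjugate w = w" by (rule eq_vecI) auto
    ultimately have "w = 0\<^sub>v nc" using conjugate_square_eq_0_vec[OF w] by simp
    then show False using inj[OF x(1)] x(2) unfolding w_def by simp
  qed
  from det_non_zero_imp_unit[OF CC this, of "()"]
  obtain B where B: "B \<in> carrier_mat n n" "B * (C * C\<^sup>T) = 1\<^sub>m n" "(C * C\<^sup>T) * B = 1\<^sub>m n"
    unfolding Units_def by (auto simp: ring_mat_simps)
  then show ?thesis
    using CC unfolding invertible_mat_def inverts_mat_def by (auto intro!: exI[of _ B])
qed

section \<open>Dimension count and the eigenvalue 1\<close>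

text \<open>If the bound failed, the \<open>m\<close> matching equations together with
  \<open>kernel_dim A\<close> equations \<open>E x = 0\<close> would be fewer than the
  \<open>p + q\<close> unknowns and have a nonzero solution. But matching puts \<open>x\<close> in
  the kernel of \<open>A\<close>, so \<open>E\<close> forces \<open>x\<close> to be zero, and then
  injectivity of \<open>V\<close> forces \<open>y\<close> to be zero.\<close>

lemma kernel_dim_ge_of_matching_pairs:
  fixes A :: "'a :: field mat"
  assumes A: "A \<in> carrier_mat nr p" and U: "U \<in> carrier_mat m p" and V: "V \<in> carrier_mat m q"
    and V_inj: "\<And>y. y \<in> carrier_vec q \<Longrightarrow> V *\<^sub>v y = 0\<^sub>v m \<Longrightarrow> y = 0\<^sub>v q"
    and match: "\<And>x y. x \<in> carrier_vec p \<Longrightarrow> y \<in> carrier_vec q \<Longrightarrow> U *\<^sub>v x + V *\<^sub>v y = 0\<^sub>v m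
      \<Longrightarrow> A *\<^sub>v x = 0\<^sub>v nr"
  shows "p + q \<le> m + kernel_dim A"
proof (rule ccontr)
  assume *: "\<not> ?thesis"
  obtain E where E: "E \<in> carrier_mat (kernel_dim A) p"
    and E0: "\<And>v. v \<in> carrier_vec p \<Longrightarrow> A *\<^sub>v v = 0\<^sub>v nr \<Longrightarrow> E *\<^sub>v v = 0\<^sub>v (kernel_dim A) \<Longrightarrow> v = 0\<^sub>v p"
    using ex_kernel_coordinates[OF A] by blast
  \<comment> \<open>The additional equations constrain \<open>x\<close> alone, hence a zero block in
    the columns of \<open>y\<close>.\<close>
  define O' :: "'a mat" where "O' = 0\<^sub>m (kernel_dim A) q"
  have O': "O' \<in> carrier_mat (kernel_dim A) q" unfolding O'_def by simp
  have W: "four_block_mat U V E O' \<in> carrier_mat (m + kernel_dim A) (p + q)"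
    using four_block_carrier_mat[OF U O'] .
  obtain z where z: "z \<in> carrier_vec (p + q)" "z \<noteq> 0\<^sub>v (p + q)"
    "four_block_mat U V E O' *\<^sub>v z = 0\<^sub>v (m + kernel_dim A)"
    using ex_nonzero_kernel_vec[OF W] * by auto
  define x y where "x = vec_first z p" and "y = vec_last z q"
  have x: "x \<in> carrier_vec p" and y: "y \<in> carrier_vec q" and z_eq: "z = x @\<^sub>v y"
    using z by (auto simp: x_def y_def)
  have "(U *\<^sub>v x + V *\<^sub>v y) @\<^sub>v (E *\<^sub>v x + O' *\<^sub>v y) = 0\<^sub>v m @\<^sub>v 0\<^sub>v (kernel_dim A)"
    using z(3) unfolding z_eq four_block_mat_mult_vec[OF U V E O' x y]
    by (auto intro!: eq_vecI)
  then have 1: "U *\<^sub>v x + V *\<^sub>v y = 0\<^sub>v m" and 2: "E *\<^sub>v x + O' *\<^sub>v y = 0\<^sub>v (kernel_dim A)"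
    using U V x y append_vec_eq[of "U *\<^sub>v x + V *\<^sub>v y" m "0\<^sub>v m"] by auto
  have "O' *\<^sub>v y = 0\<^sub>v (kernel_dim A)" unfolding O'_def using y by auto
  then have "E *\<^sub>v x = 0\<^sub>v (kernel_dim A)" using 2 E x by simp
  then have x0: "x = 0\<^sub>v p" using E0[OF x match[OF x y 1]] by simp
  have "U *\<^sub>v x = 0\<^sub>v m" unfolding x0 using U by auto
  then have "V *\<^sub>v y = 0\<^sub>v m" using 1 V y by simp
  then have "y = 0\<^sub>v q" by (rule V_inj[OF y])
  with x0 z(2) show False unfolding z_eq by auto
qed

text \<open>The approximation is prescribed through its inverse, so \<open>Shat\<^sub>2\<close>
  enters as an invertible matrix whose \<open>mat_inv\<close> is the given product. Multiplicity is
  bounded in both the geometric and the algebraic sense.\<close>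

theorem mainTheorem2:
  fixes m p :: nat
    and C S\<^sub>1 S\<^sub>2 Shat\<^sub>2 :: "real mat"
  assumes "m > p"
    and "C \<in> carrier_mat p m"
    and "vec_space.rank p C = p"
    and "S\<^sub>1 \<in> carrier_mat m m"
    and "invertible_mat S\<^sub>1"
    and "S\<^sub>2 = C * mat_inv S\<^sub>1 * C\<^sup>T"
    and "invertible_mat S\<^sub>2"
    and "invertible_mat (C * S\<^sub>1 * C\<^sup>T)"
    and "Shat\<^sub>2 \<in> carrier_mat p p"
    and "invertible_mat Shat\<^sub>2"
    and "mat_inv Shat\<^sub>2 = mat_inv (C * C\<^sup>T) * (C * S\<^sub>1 * C\<^sup>T) * mat_inv (C * C\<^sup>T)"
    and "real p > real m / 2"
  shows "eigenvalue (mat_inv Shat\<^sub>2 * S\<^sub>2) 1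
    \<and> geometric_multiplicity (mat_inv Shat\<^sub>2 * S\<^sub>2) 1 \<ge> 2 * p - m
    \<and> algebraic_multiplicity (mat_inv Shat\<^sub>2 * S\<^sub>2) 1 \<ge> 2 * p - m"
proof -
  note C = assms(2) and S1 = assms(4)
  define T where "T = mat_inv S\<^sub>1"
  note T = mat_inv[OF S1 assms(5), folded T_def]
  have Ct: "C\<^sup>T \<in> carrier_mat m p" using C by simp
  have inj: "x = 0\<^sub>v p" if "x \<in> carrier_vec p" "C\<^sup>T *\<^sub>v x = 0\<^sub>v m" for x
    using full_row_rank_transpose_inj[OF C assms(3) that] .
  have CC: "C * C\<^sup>T \<in> carrier_mat p p" using C by simp
  define G where "G = mat_inv (C * C\<^sup>T)"
  note G = mat_inv[OF CC invertible_mat_mult_transpose[OF C inj], folded G_def]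
  define M where "M = mat_inv Shat\<^sub>2 * S\<^sub>2"
  have M_eq: "M = G * (C * S\<^sub>1 * C\<^sup>T) * G * (C * T * C\<^sup>T)"
    unfolding M_def assms(11) assms(6) G_def T_def ..
  have M: "M \<in> carrier_mat p p" unfolding M_eq using C G(1) by (intro carrier_matI) auto
  \<comment> \<open>The sign turns the relation \<open>C\<^sup>T x = S\<^sub>1 C\<^sup>T y\<close>
    into the homogeneous form required by the dimension count.\<close>
  define V where "V = - (S\<^sub>1 * C\<^sup>T)"
  have V: "V \<in> carrier_mat m p" unfolding V_def using S1 Ct by simp
  have V_mult: "V *\<^sub>v y = - (S\<^sub>1 *\<^sub>v (C\<^sup>T *\<^sub>v y))" if y: "y \<in> carrier_vec p" for y
    unfolding V_def using S1 Ct y by (simp add: uminus_mult_mat_vec)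
  have TS: "T *\<^sub>v (S\<^sub>1 *\<^sub>v v) = v" if v: "v \<in> carrier_vec m" for v
    using assoc_mult_mat_vec[OF T(1) S1 v] T(3) v by simp
  have "p + p \<le> m + kernel_dim (char_matrix M 1)"
  proof (rule kernel_dim_ge_of_matching_pairs[OF _ Ct V])
    show "char_matrix M 1 \<in> carrier_mat p p" using M by simp
  next
    \<comment> \<open>Injectivity of \<open>V\<close>: cancel \<open>S\<^sub>1\<close> by its
      inverse \<open>T\<close>, then use that the transpose of \<open>C\<close> is
      injective.\<close>
    fix y assume y: "y \<in> carrier_vec p" and Vy: "V *\<^sub>v y = 0\<^sub>v m"
    have Cy: "C\<^sup>T *\<^sub>v y \<in> carrier_vec m" using Ct y by simp
    have SCy: "S\<^sub>1 *\<^sub>v (C\<^sup>T *\<^sub>v y) \<in> carrier_vec m" using S1 Cy by simp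
    have "S\<^sub>1 *\<^sub>v (C\<^sup>T *\<^sub>v y) = - 0\<^sub>v m"
      using Vy SCy unfolding V_mult[OF y] by (metis uminus_uminus_vec)
    then have "C\<^sup>T *\<^sub>v y = T *\<^sub>v (- 0\<^sub>v m)" using TS[OF Cy] by simp
    also have "\<dots> = 0\<^sub>v m" using T(1) by (intro eq_vecI) auto
    finally show "y = 0\<^sub>v p" using inj y by simp
  next
    fix x y assume x: "x \<in> carrier_vec p" and y: "y \<in> carrier_vec p"
      and xy: "C\<^sup>T *\<^sub>v x + V *\<^sub>v y = 0\<^sub>v m"
    have Cx: "C\<^sup>T *\<^sub>v x \<in> carrier_vec m" and Cy: "C\<^sup>T *\<^sub>v y \<in> carrier_vec m"
      using Ct x y by auto
    have SCy: "S\<^sub>1 *\<^sub>v (C\<^sup>T *\<^sub>v y) \<in> carrier_vec m" using S1 Cy by simp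
    have eqI: "a = b" if "a + - b = 0\<^sub>v m" "a \<in> carrier_vec m" "b \<in> carrier_vec m" for a b :: "real vec"
    proof (rule eq_vecI)
      fix i assume "i < dim_vec b"
      then have i: "i < m" using that(3) by simp
      have "a $ i - b $ i = (a + - b) $ i" using i that(2,3) by simp
      also have "\<dots> = 0" unfolding that(1) using i by simp
      finally show "a $ i = b $ i" by simp
    qed (use that in auto)
    have CxS: "C\<^sup>T *\<^sub>v x = S\<^sub>1 *\<^sub>v (C\<^sup>T *\<^sub>v y)"
      using eqI[OF _ Cx SCy] xy unfolding V_mult[OF y] .
    have GCC: "G *\<^sub>v (C *\<^sub>v (C\<^sup>T *\<^sub>v w)) = w" if w: "w \<in> carrier_vec p" for w
      using assoc_mult_mat_vec[OF G(1) CC w] assoc_mult_mat_vec[OF C Ct w] G(3) w by simp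
    have Sy: "S\<^sub>1 *\<^sub>v (C\<^sup>T *\<^sub>v y) = C\<^sup>T *\<^sub>v x" using CxS ..
    \<comment> \<open>Associativity with the carriers replaced by dimension equations, so that the
      simplifier can unfold the whole product \<open>M\<close> applied to \<open>x\<close>.\<close>
    have mv: "(K * L) *\<^sub>v v = K *\<^sub>v (L *\<^sub>v v)"
      if "dim_col K = dim_row L" "dim_vec v = dim_col L" for K L :: "real mat" and v
      using that by (intro assoc_mult_mat_vec[of _ "dim_row K" "dim_row L" _ "dim_col L"]) (auto intro: carrier_vecI)
    have "M *\<^sub>v x = G *\<^sub>v (C *\<^sub>v (S\<^sub>1 *\<^sub>v (C\<^sup>T *\<^sub>v (G *\<^sub>v (C *\<^sub>v (T *\<^sub>v (C\<^sup>T *\<^sub>v x)))))))"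
      unfolding M_eq using C S1 T(1) G(1) Ct x
      by (simp add: mv)
    also have "T *\<^sub>v (C\<^sup>T *\<^sub>v x) = C\<^sup>T *\<^sub>v y" unfolding CxS by (rule TS[OF Cy])
    also have "G *\<^sub>v (C *\<^sub>v (C\<^sup>T *\<^sub>v y)) = y" by (rule GCC[OF y])
    also have "G *\<^sub>v (C *\<^sub>v (S\<^sub>1 *\<^sub>v (C\<^sup>T *\<^sub>v y))) = x" unfolding Sy by (rule GCC[OF x])
    finally have Mx: "M *\<^sub>v x = x" .
    \<comment> \<open>\<open>char_matrix M 1\<close> is \<open>M\<close> minus the identity, so its
      kernel consists of the fixed vectors of \<open>M\<close>.\<close>
    have "char_matrix M 1 *\<^sub>v x = M *\<^sub>v x + (- 1) \<cdot>\<^sub>v x"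
      unfolding char_matrix_def using M x
      by (intro eq_vecI) (auto simp: add_scalar_prod_distrib[of _ p])
    then show "char_matrix M 1 *\<^sub>v x = 0\<^sub>v p"
      unfolding Mx using x by (intro eq_vecI) auto
  qed
  then have geo: "2 * p - m \<le> geometric_multiplicity M 1"
    unfolding geometric_multiplicity_def by simp
  also note geometric_le_algebraic_multiplicity[OF M]
  finally have alg: "2 * p - m \<le> algebraic_multiplicity M 1" .
  \<comment> \<open>Since \<open>p > m / 2\<close>, the natural-number difference is not truncated
    to 0. The root order at 1 is thus positive, which makes 1 an eigenvalue.\<close>
  moreover have "0 < 2 * p - m" using assms(12) by simp
  ultimately have "poly (char_poly M) 1 = 0"
    unfolding algebraic_multiplicity_def by (metis bot_nat_0.not_eq_extremum le_zero_eq order_root)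
  with geo alg show ?thesis
    unfolding M_def[symmetric] eigenvalue_root_char_poly[OF M] by simp
qed

end
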